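(* Let $I$ be an ideal of a commutative ring $R$, and equip $R$ with the $I$-adic topology. Then the following are equalities of topological spaces: $$\pi_{0}(R)=R/\Big(\bigcap_{n\geqslant 1}I^{n}\Big)=t(R).$$ That is, the set of connected components of $R$, the set of cosets of the ideal $\bigcap_{n\geqslant 1}I^{n}$ in $R$, and the set of irreducible closed subsets of $R$ are the same set of subsets of $R$, and the topologies of $\pi_0(R)$, $R/(\bigcap_{n\geqslant 1}I^{n})$ and $t(R)$ on this set coincide.
   Context: Rings are commutative with identity. The $I$-adic topology on $R$ is the topology having as a base of open sets all cosets $a+I^{n}$ with $a\in R$ and $n\geqslant 1$. For a topological space $X$, $\pi_{0}(X)$ is the space of connected components of $X$, with the quotient topology from $X$ (via the map sending each point to its connected component). The set $t(X)$ is the set of all irreducible closed subsets of $X$ (irreducible subsets are nonempty), topologized so that its closed subsets are precisely the sets $t(E)=\{Z\in t(X): Z\subseteq E\}$ with $E$ a closed subset of $X$. The set $R/(\bigcap_{n\geqslant1}I^{n})$ of cosets carries the quotient topology from $R$. *)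

theory Defs
  imports "HOL-Analysis.Analysis" "HOL-Algebra.Ideal_Product" "HOL-Algebra.QuotRing"
begin

section \<open>The adic topology\<close>

text \<open>The power is taken in the multiplicative monoid of ideals, so that it is the ideal
  generated by the \<open>n\<close>-fold products of elements of \<open>I\<close>, and \<open>ideal_power R I 0 = carrier R\<close>.\<close>

definition ideal_power :: "('a, 'b) ring_scheme \<Rightarrow> 'a set \<Rightarrow> nat \<Rightarrow> 'a set" where
  "ideal_power R I n = I [^]\<^bsub>ideals_set R\<^esub> n"

definition adic_base :: "('a, 'b) ring_scheme \<Rightarrow> 'a set \<Rightarrow> 'a set set" where
  "adic_base R I = {ideal_power R I n +>\<^bsub>R\<^esub> a | a n. a \<in> carrier R \<and> n \<ge> 1}"

definition adic_topology :: "('a, 'b) ring_scheme \<Rightarrow> 'a set \<Rightarrow> 'a topology" where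
  "adic_topology R I = topology (arbitrary union_of (\<lambda>U. U \<in> adic_base R I))"

lemma ideal_power_0 [simp]: "ideal_power R I 0 = carrier R"
  by (simp add: ideal_power_def ideals_set_def)

lemma ideal_power_Suc [simp]: "ideal_power R I (Suc n) = ideal_power R I n \<cdot>\<^bsub>R\<^esub> I"
  by (simp add: ideal_power_def ideals_set_def)

lemma (in ring) ideal_ideal_power:
  assumes "ideal I R"
  shows "ideal (ideal_power R I n) R"
  by (induction n) (use assms ideal_prod_is_ideal oneideal in auto)

lemma (in ring) ideal_power_antimono:
  assumes "ideal I R" "m \<le> n"
  shows "ideal_power R I n \<subseteq> ideal_power R I m"
  using assms(2)
proof (induction n rule: dec_induct)
  case base
  show ?case by simp
next
  case (step n)
  then show ?case
    using ideal_prod_inter[OF ideal_ideal_power[OF assms(1)] assms(1), of n] by auto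
qed

lemma (in ring) openin_adic_topology:
  assumes I: "ideal I R"
  shows "openin (adic_topology R I) = (arbitrary union_of (\<lambda>U. U \<in> adic_base R I))"
proof -
  have "(arbitrary union_of (\<lambda>U. U \<in> adic_base R I)) (S \<inter> T)"
    if S: "S \<in> adic_base R I" and T: "T \<in> adic_base R I" for S T
  proof -
    obtain a m where a: "S = ideal_power R I m +> a" "a \<in> carrier R" "m \<ge> 1"
      using S by (auto simp: adic_base_def)
    obtain b n where b: "T = ideal_power R I n +> b" "b \<in> carrier R" "n \<ge> 1"
      using T by (auto simp: adic_base_def)
    have "\<exists>W. W \<in> adic_base R I \<and> x \<in> W \<and> W \<subseteq> S \<inter> T" if x: "x \<in> S \<inter> T" for x
    proof -
      interpret A: ideal "ideal_power R I m" R by (rule ideal_ideal_power[OF I])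
      interpret B: ideal "ideal_power R I n" R by (rule ideal_ideal_power[OF I])
      interpret C: ideal "ideal_power R I (max m n)" R by (rule ideal_ideal_power[OF I])
      have xc: "x \<in> carrier R"
        using x a A.a_subset a_r_coset_subset_G by blast
      have "S = ideal_power R I m +> x" "T = ideal_power R I n +> x"
        using x a b A.a_repr_independence'[of x a] B.a_repr_independence'[of x b] by auto
      moreover have "ideal_power R I (max m n) +> x \<subseteq> ideal_power R I k +> x"
        if "k \<le> max m n" for k
        using ideal_power_antimono[OF I that] by (auto simp: a_r_coset_def')
      ultimately have "ideal_power R I (max m n) +> x \<subseteq> S \<inter> T"
        by simp
      moreover have "x \<in> ideal_power R I (max m n) +> x"
        using xc C.a_rcos_self by blast
      moreover have "ideal_power R I (max m n) +> x \<in> adic_base R I"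
        using xc a(3) unfolding adic_base_def by (intro CollectI exI[of _ x] exI[of _ "max m n"]) simp
      ultimately show ?thesis
        by (intro exI[of _ "ideal_power R I (max m n) +> x"] conjI)
    qed
    then show ?thesis
      unfolding arbitrary_union_of_alt by (intro ballI)
  qed
  then have "istopology (arbitrary union_of (\<lambda>U. U \<in> adic_base R I))"
    by (simp add: istopology_base_eq)
  then show ?thesis
    by (simp add: adic_topology_def)
qed

lemma (in ring) topspace_adic_topology:
  assumes I: "ideal I R"
  shows "topspace (adic_topology R I) = carrier R"
proof
  have "U \<subseteq> carrier R" if U: "U \<in> adic_base R I" for U
  proof -
    obtain a n where "U = ideal_power R I n +> a" "a \<in> carrier R"
      using U unfolding adic_base_def by blast
    moreover have "ideal_power R I n \<subseteq> carrier R"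
      using ideal.Icarr[OF ideal_ideal_power[OF I]] by blast
    ultimately show ?thesis
      using a_r_coset_subset_G by simp
  qed
  then show "topspace (adic_topology R I) \<subseteq> carrier R"
    unfolding topspace_def openin_adic_topology[OF I] union_of_def by blast
  show "carrier R \<subseteq> topspace (adic_topology R I)"
  proof
    fix a assume a: "a \<in> carrier R"
    have "ideal_power R I 1 +> a \<in> adic_base R I"
      using a unfolding adic_base_def by blast
    then have "openin (adic_topology R I) (ideal_power R I 1 +> a)"
      unfolding openin_adic_topology[OF I] by (rule arbitrary_union_of_inc)
    moreover have "a \<in> ideal_power R I 1 +> a"
    proof -
      interpret P: ideal "ideal_power R I 1" R by (rule ideal_ideal_power[OF I])
      show ?thesis by (rule P.a_rcos_self[OF a])
    qed
    ultimately show "a \<in> topspace (adic_topology R I)"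
      by (auto simp: topspace_def)
  qed
qed


section \<open>Quotient topologies and the space of connected components\<close>

definition quotient_topology :: "'a topology \<Rightarrow> ('a \<Rightarrow> 'b) \<Rightarrow> 'b topology" where
  "quotient_topology X f =
    topology (\<lambda>U. U \<subseteq> f ` topspace X \<and> openin X {x \<in> topspace X. f x \<in> U})"

definition pi0_space :: "'a topology \<Rightarrow> 'a set topology" where
  "pi0_space X = quotient_topology X (connected_component_of_set X)"

lemma openin_quotient_topology:
  "openin (quotient_topology X f) U \<longleftrightarrow>
    U \<subseteq> f ` topspace X \<and> openin X {x \<in> topspace X. f x \<in> U}"
proof -
  have "istopology (\<lambda>U. U \<subseteq> f ` topspace X \<and> openin X {x \<in> topspace X. f x \<in> U})"
    unfolding istopology_def
  proof (intro conjI allI impI)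
    fix S T
    assume "S \<subseteq> f ` topspace X \<and> openin X {x \<in> topspace X. f x \<in> S}"
      and "T \<subseteq> f ` topspace X \<and> openin X {x \<in> topspace X. f x \<in> T}"
    moreover have "{x \<in> topspace X. f x \<in> S \<inter> T} =
        {x \<in> topspace X. f x \<in> S} \<inter> {x \<in> topspace X. f x \<in> T}" by auto
    ultimately show "S \<inter> T \<subseteq> f ` topspace X" "openin X {x \<in> topspace X. f x \<in> S \<inter> T}"
      by (auto intro: openin_Int)
  next
    fix K
    assume K: "\<forall>S\<in>K. S \<subseteq> f ` topspace X \<and> openin X {x \<in> topspace X. f x \<in> S}"
    then show "\<Union>K \<subseteq> f ` topspace X" by blast
    have "{x \<in> topspace X. f x \<in> \<Union>K} = (\<Union>S\<in>K. {x \<in> topspace X. f x \<in> S})" by auto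
    then show "openin X {x \<in> topspace X. f x \<in> \<Union>K}"
      using K by auto
  qed
  then show ?thesis
    by (simp add: quotient_topology_def)
qed

lemma topspace_quotient_topology: "topspace (quotient_topology X f) = f ` topspace X"
proof
  show "topspace (quotient_topology X f) \<subseteq> f ` topspace X"
    by (metis openin_quotient_topology openin_topspace)
  have "{x \<in> topspace X. f x \<in> f ` topspace X} = topspace X" by auto
  then have "openin (quotient_topology X f) (f ` topspace X)"
    by (simp add: openin_quotient_topology)
  then show "f ` topspace X \<subseteq> topspace (quotient_topology X f)"
    by (rule openin_subset)
qed

lemma quotient_map_quotient_topology: "quotient_map X (quotient_topology X f) f"
  by (auto simp: quotient_map_def topspace_quotient_topology openin_quotient_topology)

lemma topspace_pi0_space: "topspace (pi0_space X) = connected_components_of X"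
  by (simp add: pi0_space_def topspace_quotient_topology connected_components_of_def)


section \<open>The space of irreducible closed subsets\<close>

definition irreducible_in :: "'a topology \<Rightarrow> 'a set \<Rightarrow> bool" where
  "irreducible_in X S \<longleftrightarrow> S \<subseteq> topspace X \<and> S \<noteq> {} \<and>
    \<not> (\<exists>A B. closedin (subtopology X S) A \<and> closedin (subtopology X S) B \<and>
          A \<subset> S \<and> B \<subset> S \<and> S = A \<union> B)"

definition irreducible_closed_subsets :: "'a topology \<Rightarrow> 'a set set" where
  "irreducible_closed_subsets X = {Z. closedin X Z \<and> irreducible_in X Z}"

text \<open>The closed sets are the \<open>t(E) = {Z \<in> irreducible_closed_subsets X. Z \<subseteq> E}\<close> with
  \<open>E\<close> closed in \<open>X\<close>; see \<open>closedin_t_space\<close> below.\<close>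

definition t_space :: "'a topology \<Rightarrow> 'a set topology" where
  "t_space X = topology (\<lambda>U. \<exists>E. closedin X E \<and>
    U = irreducible_closed_subsets X - {Z \<in> irreducible_closed_subsets X. Z \<subseteq> E})"

lemma irreducible_in_subset_Un:
  assumes "irreducible_in X Z" "closedin X E" "closedin X F" "Z \<subseteq> E \<union> F"
  shows "Z \<subseteq> E \<or> Z \<subseteq> F"
proof (rule ccontr)
  assume "\<not> (Z \<subseteq> E \<or> Z \<subseteq> F)"
  then have "E \<inter> Z \<subset> Z" "F \<inter> Z \<subset> Z" "Z = (E \<inter> Z) \<union> (F \<inter> Z)"
    using assms(4) by auto
  moreover have "closedin (subtopology X Z) (E \<inter> Z)" "closedin (subtopology X Z) (F \<inter> Z)"
    using assms(2,3) by (auto simp: closedin_subtopology)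
  ultimately show False
    using assms(1) unfolding irreducible_in_def by blast
qed

lemma openin_t_space:
  "openin (t_space X) U \<longleftrightarrow> (\<exists>E. closedin X E \<and>
    U = irreducible_closed_subsets X - {Z \<in> irreducible_closed_subsets X. Z \<subseteq> E})"
proof -
  let ?T = "irreducible_closed_subsets X"
  have "istopology (\<lambda>U. \<exists>E. closedin X E \<and> U = ?T - {Z \<in> ?T. Z \<subseteq> E})"
    unfolding istopology_def
  proof (intro conjI allI impI)
    fix U V
    assume "\<exists>E. closedin X E \<and> U = ?T - {Z \<in> ?T. Z \<subseteq> E}"
      and "\<exists>E. closedin X E \<and> V = ?T - {Z \<in> ?T. Z \<subseteq> E}"
    then obtain E F where E: "closedin X E" "U = ?T - {Z \<in> ?T. Z \<subseteq> E}"
      and F: "closedin X F" "V = ?T - {Z \<in> ?T. Z \<subseteq> F}" by blast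
    have "Z \<subseteq> E \<or> Z \<subseteq> F" if "Z \<in> ?T" "Z \<subseteq> E \<union> F" for Z
      using that irreducible_in_subset_Un[OF _ E(1) F(1)]
      by (simp add: irreducible_closed_subsets_def)
    then have "U \<inter> V = ?T - {Z \<in> ?T. Z \<subseteq> E \<union> F}"
      unfolding E F by blast
    then show "\<exists>E. closedin X E \<and> U \<inter> V = ?T - {Z \<in> ?T. Z \<subseteq> E}"
      using closedin_Un[OF E(1) F(1)] by blast
  next
    fix K
    assume "\<forall>U\<in>K. \<exists>E. closedin X E \<and> U = ?T - {Z \<in> ?T. Z \<subseteq> E}"
    then obtain e where e: "\<And>U. U \<in> K \<Longrightarrow> closedin X (e U)"
      "\<And>U. U \<in> K \<Longrightarrow> U = ?T - {Z \<in> ?T. Z \<subseteq> e U}" by metis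
    let ?E = "topspace X \<inter> (\<Inter>U\<in>K. e U)"
    have "closedin X ?E"
      using e(1) by (cases "K = {}") (auto intro!: closedin_Int closedin_Inter)
    moreover have "\<Union>K = ?T - {Z \<in> ?T. Z \<subseteq> ?E}"
    proof -
      have top: "Z \<subseteq> topspace X" if "Z \<in> ?T" for Z
        using that by (simp add: irreducible_closed_subsets_def irreducible_in_def)
      have "Z \<in> U \<longleftrightarrow> Z \<in> ?T \<and> \<not> Z \<subseteq> e U" if "U \<in> K" for Z U
        by (subst e(2)[OF that]) auto
      then have "Z \<in> \<Union>K \<longleftrightarrow> Z \<in> ?T \<and> (\<exists>U\<in>K. \<not> Z \<subseteq> e U)" for Z
        by auto
      moreover have "Z \<subseteq> ?E \<longleftrightarrow> (\<forall>U\<in>K. Z \<subseteq> e U)" if "Z \<in> ?T" for Z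
        using top[OF that] by auto
      ultimately have eq: "Z \<in> \<Union>K \<longleftrightarrow> Z \<in> ?T - {Z \<in> ?T. Z \<subseteq> ?E}" for Z
        unfolding Diff_iff mem_Collect_eq by metis
      show ?thesis
        by (rule Set.set_eqI) (rule eq)
    qed
    ultimately show "\<exists>E. closedin X E \<and> \<Union>K = ?T - {Z \<in> ?T. Z \<subseteq> E}" by blast
  qed
  then show ?thesis
    by (simp add: t_space_def)
qed

lemma topspace_t_space: "topspace (t_space X) = irreducible_closed_subsets X"
proof
  show "topspace (t_space X) \<subseteq> irreducible_closed_subsets X"
    using openin_topspace[of "t_space X"] unfolding openin_t_space by blast
  have "irreducible_closed_subsets X =
      irreducible_closed_subsets X - {Z \<in> irreducible_closed_subsets X. Z \<subseteq> {}}"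
    by (auto simp: irreducible_closed_subsets_def irreducible_in_def)
  then have "openin (t_space X) (irreducible_closed_subsets X)"
    unfolding openin_t_space by (metis closedin_empty)
  then show "irreducible_closed_subsets X \<subseteq> topspace (t_space X)"
    by (rule openin_subset)
qed

lemma closedin_t_space:
  "closedin (t_space X) C \<longleftrightarrow>
    (\<exists>E. closedin X E \<and> C = {Z \<in> irreducible_closed_subsets X. Z \<subseteq> E})"
proof -
  let ?T = "irreducible_closed_subsets X"
  have "C \<subseteq> ?T \<and> ?T - C = ?T - {Z \<in> ?T. Z \<subseteq> E} \<longleftrightarrow> C = {Z \<in> ?T. Z \<subseteq> E}" for E
    by (metis (no_types, lifting) Diff_Diff_Int inf.absorb_iff2 mem_Collect_eq subsetI)
  then show ?thesis
    unfolding closedin_def[of "t_space X"] topspace_t_space openin_t_space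
    by (simp only: ex_simps(2)[symmetric] conj_left_commute)
qed

end

theory Submission
  imports Defs
begin

text \<open>Every coset of \<open>I\<^sup>n\<close> is open, and also closed, because its complement is a union of
  further cosets of \<open>I\<^sup>n\<close>.  Let \<open>J\<close> be the intersection of the powers of \<open>I\<close>.  The cosets of \<open>J\<close>
  then have two properties.  On the one hand, a neighbourhood of a point \<open>x\<close> contains some
  \<open>I\<^sup>n + x\<close> and hence \<open>J + x\<close>, so an open set that meets a coset of \<open>J\<close> contains it: the cosets of
  \<open>J\<close> are indiscrete subspaces.  On the other hand, two points in different cosets of \<open>J\<close> lie in
  different cosets of some \<open>I\<^sup>n\<close> and are thus separated by a clopen set.

  The theorem is a consequence of these two properties alone, which the locale
  \<open>clopen_separated_classes\<close> isolates.  An indiscrete subspace is connected and irreducible, and a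
  connected or irreducible set cannot be divided by a clopen set, so both the components and the
  irreducible closed sets are exactly the cosets of \<open>J\<close>.  As to the topologies, the map from a
  set of cosets to its union identifies the open sets of both quotients with the open sets of
  \<open>R\<close>.  The same holds for \<open>t(R)\<close>, since a closed set \<open>E\<close> is a union of cosets and so contains
  \<open>J + a\<close> as soon as it contains \<open>a\<close>.\<close>

section \<open>Spaces partitioned into indiscrete classes separated by clopen sets\<close>

lemma quotient_topology_cong:
  assumes "\<And>x. x \<in> topspace X \<Longrightarrow> f x = g x"
  shows "quotient_topology X f = quotient_topology X g"
proof -
  have "f ` topspace X = g ` topspace X"
    using assms by (rule image_cong[OF refl])
  moreover have "{x \<in> topspace X. f x \<in> U} = {x \<in> topspace X. g x \<in> U}" for U
    using assms by auto
  ultimately show ?thesis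
    by (simp add: quotient_topology_def)
qed

text \<open>The first two assumptions say that \<open>cls a\<close> is a set of topologically indistinguishable points
  around \<open>a\<close>, the third that it is also the quasi-component of \<open>a\<close>.\<close>

locale clopen_separated_classes =
  fixes X :: "'a topology" and cls :: "'a \<Rightarrow> 'a set"
  assumes mem_class: "a \<in> topspace X \<Longrightarrow> a \<in> cls a"
    and class_subset_open:
      "\<lbrakk>a \<in> topspace X; openin X U; cls a \<inter> U \<noteq> {}\<rbrakk> \<Longrightarrow> cls a \<subseteq> U"
    and separated:
      "\<lbrakk>a \<in> topspace X; b \<in> topspace X; b \<notin> cls a\<rbrakk>
        \<Longrightarrow> \<exists>C. openin X C \<and> closedin X C \<and> a \<in> C \<and> b \<notin> C"
begin

lemma class_subset_topspace: "a \<in> topspace X \<Longrightarrow> cls a \<subseteq> topspace X"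
  using class_subset_open[OF _ openin_topspace] mem_class by blast

lemma class_subset_closed:
  assumes "a \<in> topspace X" "closedin X E" "cls a \<inter> E \<noteq> {}"
  shows "cls a \<subseteq> E"
proof (rule ccontr)
  assume "\<not> cls a \<subseteq> E"
  then have "cls a \<inter> (topspace X - E) \<noteq> {}"
    using class_subset_topspace[OF assms(1)] by blast
  then have "cls a \<subseteq> topspace X - E"
    using class_subset_open assms(1,2) by blast
  then show False
    using assms(3) by blast
qed

lemma closedin_class:
  assumes a: "a \<in> topspace X"
  shows "closedin X (cls a)"
proof -
  have "\<exists>V. openin X V \<and> b \<in> V \<and> V \<subseteq> topspace X - cls a" if b: "b \<in> topspace X - cls a" for b
  proof -
    obtain C where C: "openin X C" "closedin X C" "a \<in> C" "b \<notin> C"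
      using separated a b by blast
    then have "cls a \<subseteq> C"
      using class_subset_open[OF a C(1)] mem_class[OF a] by blast
    then show ?thesis
      using C b by (intro exI[of _ "topspace X - C"]) auto
  qed
  then have "openin X (topspace X - cls a)"
    by (subst openin_subopen) blast
  then show ?thesis
    by (simp add: closedin_def class_subset_topspace[OF a])
qed

lemma connectedin_class:
  assumes "a \<in> topspace X"
  shows "connectedin X (cls a)"
  unfolding connectedin
  using class_subset_topspace class_subset_open assms by blast

lemma irreducible_in_class:
  assumes a: "a \<in> topspace X"
  shows "irreducible_in X (cls a)"
proof -
  have "A = {}" if A: "closedin (subtopology X (cls a)) A" "A \<subset> cls a" for A
  proof -
    obtain E where "closedin X E" "A = E \<inter> cls a"
      using A(1) by (auto simp: closedin_subtopology)
    then show ?thesis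
      using class_subset_closed[OF a] A(2) by blast
  qed
  then show ?thesis
    using class_subset_topspace[OF a] mem_class[OF a] unfolding irreducible_in_def by blast
qed

text \<open>Connected sets and irreducible sets share the property in the first assumption, and this is
  all that keeps either kind of set inside a single class.\<close>

lemma indivisible_subset_class:
  assumes "\<And>C. \<lbrakk>openin X C; closedin X C\<rbrakk> \<Longrightarrow> Z \<subseteq> C \<or> Z \<inter> C = {}"
    and "Z \<subseteq> topspace X" "a \<in> Z"
  shows "Z \<subseteq> cls a"
proof
  fix b assume b: "b \<in> Z"
  show "b \<in> cls a"
  proof (rule ccontr)
    assume "b \<notin> cls a"
    then obtain C where "openin X C" "closedin X C" "a \<in> C" "b \<notin> C"
      using separated assms(2,3) b by blast
    then show False
      using assms(1)[of C] assms(3) b by blast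
  qed
qed

lemma connected_component_of_set_eq_class:
  assumes a: "a \<in> topspace X"
  shows "connected_component_of_set X a = cls a"
proof
  let ?Z = "connected_component_of_set X a"
  show "?Z \<subseteq> cls a"
  proof (rule indivisible_subset_class)
    show "?Z \<subseteq> C \<or> ?Z \<inter> C = {}" if "openin X C" "closedin X C" for C
      using connectedin_clopen_cases[OF connectedin_connected_component_of that(2,1)]
      by (auto simp: disjnt_def)
    show "?Z \<subseteq> topspace X"
      by (rule connected_component_of_subset_topspace)
    show "a \<in> ?Z"
      using a by (simp add: connected_component_of_refl)
  qed
  show "cls a \<subseteq> ?Z"
    by (rule connected_component_of_maximal[OF connectedin_class[OF a] mem_class[OF a]])
qed

lemma connected_components_eq_classes: "connected_components_of X = cls ` topspace X"
  unfolding connected_components_of_def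
  by (rule image_cong[OF refl connected_component_of_set_eq_class])

lemma irreducible_closed_subsets_eq_classes: "irreducible_closed_subsets X = cls ` topspace X"
proof
  show "cls ` topspace X \<subseteq> irreducible_closed_subsets X"
    by (auto simp: irreducible_closed_subsets_def closedin_class irreducible_in_class)
  show "irreducible_closed_subsets X \<subseteq> cls ` topspace X"
  proof
    fix Z assume "Z \<in> irreducible_closed_subsets X"
    then have Z: "closedin X Z" "irreducible_in X Z"
      by (auto simp: irreducible_closed_subsets_def)
    then obtain a where a: "a \<in> Z" and sub: "Z \<subseteq> topspace X"
      by (auto simp: irreducible_in_def)
    have "Z \<subseteq> C \<or> Z \<inter> C = {}" if "openin X C" "closedin X C" for C
    proof -
      have "closedin X (topspace X - C)"
        using that by blast
      then have "Z \<subseteq> C \<or> Z \<subseteq> topspace X - C"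
        using irreducible_in_subset_Un[OF Z(2) that(2)] sub by blast
      then show ?thesis
        by blast
    qed
    then have "Z \<subseteq> cls a"
      using sub a by (rule indivisible_subset_class)
    moreover have "cls a \<subseteq> Z"
      using class_subset_closed[OF _ Z(1)] mem_class a sub by blast
    ultimately show "Z \<in> cls ` topspace X"
      using a sub by blast
  qed
qed

lemma pi0_space_eq_quotient: "pi0_space X = quotient_topology X cls"
  unfolding pi0_space_def
  by (rule quotient_topology_cong) (rule connected_component_of_set_eq_class)

lemma quotient_eq_t_space: "quotient_topology X cls = t_space X"
proof -
  have sub: "cls a \<subseteq> E \<longleftrightarrow> a \<in> E" if "closedin X E" "a \<in> topspace X" for E a
    using that class_subset_closed mem_class by blast
  have "openin (quotient_topology X cls) U \<longleftrightarrow> openin (t_space X) U" for U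
  proof
    assume "openin (quotient_topology X cls) U"
    then have U: "U \<subseteq> cls ` topspace X" and op: "openin X {x \<in> topspace X. cls x \<in> U}"
      by (simp_all add: openin_quotient_topology)
    define E where "E = topspace X - {x \<in> topspace X. cls x \<in> U}"
    have E: "closedin X E"
      unfolding E_def using op by blast
    have "U = cls ` topspace X - {Z \<in> cls ` topspace X. Z \<subseteq> E}"
      using U sub[OF E] by (auto simp: E_def)
    then show "openin (t_space X) U"
      unfolding openin_t_space irreducible_closed_subsets_eq_classes using E by blast
  next
    assume "openin (t_space X) U"
    then obtain E where E: "closedin X E"
      and U: "U = cls ` topspace X - {Z \<in> cls ` topspace X. Z \<subseteq> E}"
      unfolding openin_t_space irreducible_closed_subsets_eq_classes by blast
    have "{x \<in> topspace X. cls x \<in> U} = topspace X - E"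
      unfolding U using sub[OF E] by auto
    then show "openin (quotient_topology X cls) U"
      using E U by (auto simp: openin_quotient_topology)
  qed
  then show ?thesis
    by (simp add: topology_eq)
qed

end


section \<open>Cosets in the adic topology\<close>

context ring
begin

lemma openin_adic_coset:
  assumes "ideal I R" "n \<ge> 1" "a \<in> carrier R"
  shows "openin (adic_topology R I) (ideal_power R I n +> a)"
  unfolding openin_adic_topology[OF assms(1)]
  by (rule arbitrary_union_of_inc) (use assms in \<open>auto simp: adic_base_def\<close>)

lemma closedin_adic_coset:
  assumes I: "ideal I R" and n: "n \<ge> 1" and a: "a \<in> carrier R"
  shows "closedin (adic_topology R I) (ideal_power R I n +> a)"
proof -
  interpret P: ideal "ideal_power R I n" R by (rule ideal_ideal_power[OF I])
  let ?P = "ideal_power R I n"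
  have "\<exists>V. openin (adic_topology R I) V \<and> b \<in> V \<and> V \<subseteq> carrier R - (?P +> a)"
    if b: "b \<in> carrier R - (?P +> a)" for b
  proof (intro exI conjI)
    have bc: "b \<in> carrier R" using b by blast
    show "openin (adic_topology R I) (?P +> b)"
      by (rule openin_adic_coset[OF I n bc])
    show b_self: "b \<in> ?P +> b"
      by (rule P.a_rcos_self[OF bc])
    show "?P +> b \<subseteq> carrier R - (?P +> a)"
    proof
      fix x assume x: "x \<in> ?P +> b"
      have "x \<notin> ?P +> a"
        using P.a_repr_independence'[OF x bc] P.a_repr_independence'[OF _ a, of x] b b_self
        by auto
      then show "x \<in> carrier R - (?P +> a)"
        using x a_r_coset_subset_G[OF P.a_subset bc] by blast
    qed
  qed
  then have "openin (adic_topology R I) (carrier R - (?P +> a))"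
    by (subst openin_subopen) blast
  then show ?thesis
    using a_r_coset_subset_G[OF P.a_subset a]
    by (simp add: closedin_def topspace_adic_topology[OF I])
qed

lemma adic_open_contains_coset:
  assumes I: "ideal I R" and U: "openin (adic_topology R I) U" and x: "x \<in> U"
  shows "\<exists>n\<ge>1. ideal_power R I n +> x \<subseteq> U"
proof -
  obtain V where V: "V \<in> adic_base R I" "x \<in> V" "V \<subseteq> U"
    using U x unfolding openin_adic_topology[OF I] arbitrary_union_of_alt by blast
  then obtain a n where a: "V = ideal_power R I n +> a" "a \<in> carrier R" "n \<ge> 1"
    by (auto simp: adic_base_def)
  interpret P: ideal "ideal_power R I n" R by (rule ideal_ideal_power[OF I])
  have "ideal_power R I n +> x = V"
    using P.a_repr_independence'[of x a] V(2) a by simp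
  then show ?thesis
    using V(3) a(3) by blast
qed

lemma ideal_Inter_ideal_power:
  assumes "ideal I R"
  shows "ideal (\<Inter>n\<in>{1..}. ideal_power R I n) R"
  by (rule i_Intersect) (use ideal_ideal_power[OF assms] in auto)

lemma adic_clopen_separated_classes:
  assumes I: "ideal I R"
  shows "clopen_separated_classes (adic_topology R I)
    (\<lambda>a. (\<Inter>n\<in>{1..}. ideal_power R I n) +> a)"
proof
  define J where "J = (\<Inter>n\<in>{1..}. ideal_power R I n)"
  interpret J: ideal J R
    unfolding J_def by (rule ideal_Inter_ideal_power[OF I])
  note top = topspace_adic_topology[OF I]
  fix a assume "a \<in> topspace (adic_topology R I)"
  then have a: "a \<in> carrier R" by (simp add: top)
  show "a \<in> (\<Inter>n\<in>{1..}. ideal_power R I n) +> a"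
    using J.a_rcos_self[OF a] by (simp add: J_def)
  show "(\<Inter>n\<in>{1..}. ideal_power R I n) +> a \<subseteq> U"
    if U: "openin (adic_topology R I) U"
      and meet: "((\<Inter>n\<in>{1..}. ideal_power R I n) +> a) \<inter> U \<noteq> {}" for U
  proof -
    obtain x where x: "x \<in> J +> a" "x \<in> U"
      using meet unfolding J_def by blast
    obtain n where n: "n \<ge> 1" "ideal_power R I n +> x \<subseteq> U"
      using adic_open_contains_coset[OF I U x(2)] by blast
    have "J +> x \<subseteq> ideal_power R I n +> x"
      using n(1) by (auto simp: J_def a_r_coset_def')
    then have "J +> a \<subseteq> U"
      using J.a_repr_independence'[OF x(1) a] n(2) by simp
    then show ?thesis
      by (simp add: J_def)
  qed
  show "\<exists>C. openin (adic_topology R I) C \<and> closedin (adic_topology R I) C \<and> a \<in> C \<and> b \<notin> C"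
    if "b \<in> topspace (adic_topology R I)"
      and notin: "b \<notin> (\<Inter>n\<in>{1..}. ideal_power R I n) +> a" for b
  proof -
    have b: "b \<in> carrier R"
      using that(1) by (simp add: top)
    have "b \<oplus> \<ominus> a \<notin> J"
      using notin J.a_rcos_module[OF a b] by (simp add: J_def)
    then obtain n where n: "n \<ge> 1" "b \<oplus> \<ominus> a \<notin> ideal_power R I n"
      by (auto simp: J_def)
    interpret P: ideal "ideal_power R I n" R by (rule ideal_ideal_power[OF I])
    have "b \<notin> ideal_power R I n +> a"
      using n(2) P.a_rcos_module[OF a b] by simp
    then show ?thesis
      using openin_adic_coset[OF I n(1) a] closedin_adic_coset[OF I n(1) a] P.a_rcos_self[OF a]
      by blast
  qed
qed

end


section \<open>Components, cosets and irreducible closed sets\<close>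

theorem theorem1p1:
  fixes R :: "('a, 'b) ring_scheme" (structure) and I :: "'a set"
  assumes "cring R" and "ideal I R"
  shows "let X = adic_topology R I; J = (\<Inter>n\<in>{1..}. ideal_power R I n) in
    connected_components_of X = carrier (R Quot J) \<and>
    carrier (R Quot J) = irreducible_closed_subsets X \<and>
    pi0_space X = quotient_topology X (\<lambda>a. J +> a) \<and>
    quotient_topology X (\<lambda>a. J +> a) = t_space X"
proof -
  interpret ring R
    using assms(2) by (rule ideal.axioms(2))
  define J where "J = (\<Inter>n\<in>{1..}. ideal_power R I n)"
  interpret clopen_separated_classes "adic_topology R I" "\<lambda>a. J +> a"
    unfolding J_def by (rule adic_clopen_separated_classes[OF assms(2)])
  have "carrier (R Quot J) = (\<lambda>a. J +> a) ` topspace (adic_topology R I)"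
    by (auto simp: FactRing_def A_RCOSETS_def' topspace_adic_topology[OF assms(2)])
  then show ?thesis
    unfolding Let_def J_def[symmetric]
    using connected_components_eq_classes irreducible_closed_subsets_eq_classes
      pi0_space_eq_quotient quotient_eq_t_space
    by simp
qed

end
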